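(* Consider the mixed-integer formulation described in the context. Let $(x,y,u)$ be any assignment with $x^t_{od},y^t_r\in\{0,1\}$ and $u^t_v$ integers that satisfies constraints (F4), (F5), (F6), (F7), (F8) and (F12). Then, for every truck $t\in T$ with $D_t\neq\emptyset$, the route $S_t$ satisfies the Hamiltonian cycle condition: (i) every location $v\in P_t=\{0\}\cup\bigcup_{r\in D_t}\{f(r),g(r)\}$ is entered by truck $t$ exactly once and departed by truck $t$ exactly once, where arcs of the form $(v,v)$ are not counted (i.e., there is exactly one $o\neq v$ with $x^t_{ov}=1$ and exactly one $d\neq v$ with $x^t_{vd}=1$); and (ii) $S_t$ contains no subtour, i.e., no directed cycle formed by arcs $(o,d)\in S_t$ with $o\neq d$ that avoids the depot $0$.
   Context: Profit-maximizing multi-vehicle pickup and delivery selection problem (location-based model). $V$ is a finite set of locations containing a depot $0$; $|V|$ denotes its cardinality. $T$ is a finite set of trucks, truck $t$ having capacity $c^t$ and arc costs $l^t_{od}$ ($o,d\in V$). $R$ is a finite set of requests; each $r\in R$ has a payment $w_r$, a volume $q_r$, a loading point $f(r)\in V\setminus\{0\}$ and an unloading point $g(r)\in V\setminus\{0\}$. Variables: Booleans $x^t_{od}$ ($t\in T$, $o,d\in V$; equal to 1 iff truck $t$ traverses arc $(o,d)$), Booleans $y^t_r$ ($t\in T$, $r\in R$; equal to 1 iff request $r$ is assigned to truck $t$), integers $u^t_v$ and $h^t_v$ ($t\in T$, $v\in V\setminus\{0\}$). Write $D_t=\{r\in R: y^t_r=1\}$ (delivery of truck $t$) and $S_t=\{(o,d):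 x^t_{od}=1\}$ (route of truck $t$). Constraints of the formulation (objective: maximize $\sum_{r,t}w_r y^t_r-\sum_{t,o,d}l^t_{od}x^t_{od}$): (F3) $\sum_{t\in T}y^t_r\le 1$ for all $r\in R$; (F4) $y^t_r\le\sum_{o\in V,\,o\neq f(r)}x^t_{of(r)}$ for all $t\in T,r\in R$; (F5) $y^t_r\le\sum_{o\in V,\,o\neq g(r)}x^t_{og(r)}$ for all $t\in T,r\in R$; (F6) $\sum_{d\in V}x^t_{od}-\sum_{d\in V}x^t_{do}=0$ for all $t\in T,o\in V$; (F7) $\sum_{d\in V,\,d\neq o}x^t_{od}\le 1$ for all $t\in T,o\in V$; (F8) $u^t_d-u^t_o\ge 1-|V|(1-x^t_{od})$ for all $t\in T$, $o,d\in V\setminus\{0\}$, $o\neq d$; (F12) $0\le u^t_v\le |V|-2$ for all $t\in T$, $v\in V\setminus\{0\}$. *)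

theory Defs
  imports Complex_Main "Graph_Theory.Arc_Walk"
begin

record ('v, 't, 'r) pdp =
  locs :: "'v set"
  depot :: 'v
  trucks :: "'t set"
  capacity :: "'t \<Rightarrow> real"
  arc_cost :: "'t \<Rightarrow> 'v \<Rightarrow> 'v \<Rightarrow> real"
  requests :: "'r set"
  payment :: "'r \<Rightarrow> real"
  volume :: "'r \<Rightarrow> real"
  loading :: "'r \<Rightarrow> 'v"
  unloading :: "'r \<Rightarrow> 'v"

definition pdp_instance :: "('v, 't, 'r) pdp \<Rightarrow> bool" where
  "pdp_instance I \<longleftrightarrow>
     finite (locs I) \<and> depot I \<in> locs I \<and> finite (trucks I) \<and> finite (requests I) \<and>
     (\<forall>r\<in>requests I. loading I r \<in> locs I - {depot I} \<and> unloading I r \<in> locs I - {depot I})"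

text \<open>
  Decision variables are integer-valued functions: \<open>x t a b\<close> (truck \<open>t\<close> traverses arc \<open>(a, b)\<close>),
  \<open>y t r\<close> (request \<open>r\<close> is assigned to truck \<open>t\<close>) and the ordering variable \<open>u t v\<close>.
  Their values are relevant only on the index sets of the instance.
\<close>

definition binary_vars ::
    "('v, 't, 'r) pdp \<Rightarrow> ('t \<Rightarrow> 'v \<Rightarrow> 'v \<Rightarrow> int) \<Rightarrow> ('t \<Rightarrow> 'r \<Rightarrow> int) \<Rightarrow> bool" where
  "binary_vars I x y \<longleftrightarrow>
     (\<forall>t\<in>trucks I. \<forall>a\<in>locs I. \<forall>b\<in>locs I. x t a b \<in> {0, 1}) \<and>
     (\<forall>t\<in>trucks I. \<forall>r\<in>requests I. y t r \<in> {0, 1})"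

definition loading_visited ::
    "('v, 't, 'r) pdp \<Rightarrow> ('t \<Rightarrow> 'v \<Rightarrow> 'v \<Rightarrow> int) \<Rightarrow> ('t \<Rightarrow> 'r \<Rightarrow> int) \<Rightarrow> bool" where
  "loading_visited I x y \<longleftrightarrow>
     (\<forall>t\<in>trucks I. \<forall>r\<in>requests I. y t r \<le> (\<Sum>a\<in>locs I - {loading I r}. x t a (loading I r)))"

definition unloading_visited ::
    "('v, 't, 'r) pdp \<Rightarrow> ('t \<Rightarrow> 'v \<Rightarrow> 'v \<Rightarrow> int) \<Rightarrow> ('t \<Rightarrow> 'r \<Rightarrow> int) \<Rightarrow> bool" where
  "unloading_visited I x y \<longleftrightarrow>
     (\<forall>t\<in>trucks I. \<forall>r\<in>requests I. y t r \<le> (\<Sum>a\<in>locs I - {unloading I r}. x t a (unloading I r)))"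

definition flow_conservation ::
    "('v, 't, 'r) pdp \<Rightarrow> ('t \<Rightarrow> 'v \<Rightarrow> 'v \<Rightarrow> int) \<Rightarrow> bool" where
  "flow_conservation I x \<longleftrightarrow>
     (\<forall>t\<in>trucks I. \<forall>a\<in>locs I. (\<Sum>b\<in>locs I. x t a b) - (\<Sum>b\<in>locs I. x t b a) = 0)"

definition departed_at_most_once ::
    "('v, 't, 'r) pdp \<Rightarrow> ('t \<Rightarrow> 'v \<Rightarrow> 'v \<Rightarrow> int) \<Rightarrow> bool" where
  "departed_at_most_once I x \<longleftrightarrow>
     (\<forall>t\<in>trucks I. \<forall>a\<in>locs I. (\<Sum>b\<in>locs I - {a}. x t a b) \<le> 1)"

text \<open>The Miller--Tucker--Zemlin constraints and the bounds on the ordering variables.\<close>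

definition mtz_order ::
    "('v, 't, 'r) pdp \<Rightarrow> ('t \<Rightarrow> 'v \<Rightarrow> 'v \<Rightarrow> int) \<Rightarrow> ('t \<Rightarrow> 'v \<Rightarrow> int) \<Rightarrow> bool" where
  "mtz_order I x u \<longleftrightarrow>
     (\<forall>t\<in>trucks I. \<forall>a\<in>locs I - {depot I}. \<forall>b\<in>locs I - {depot I}. a \<noteq> b \<longrightarrow>
        u t b - u t a \<ge> 1 - int (card (locs I)) * (1 - x t a b))"

definition mtz_bounds :: "('v, 't, 'r) pdp \<Rightarrow> ('t \<Rightarrow> 'v \<Rightarrow> int) \<Rightarrow> bool" where
  "mtz_bounds I u \<longleftrightarrow>
     (\<forall>t\<in>trucks I. \<forall>v\<in>locs I - {depot I}. 0 \<le> u t v \<and> u t v \<le> int (card (locs I)) - 2)"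

definition delivery :: "('v, 't, 'r) pdp \<Rightarrow> ('t \<Rightarrow> 'r \<Rightarrow> int) \<Rightarrow> 't \<Rightarrow> 'r set" where
  "delivery I y t = {r \<in> requests I. y t r = 1}"

definition route :: "('v, 't, 'r) pdp \<Rightarrow> ('t \<Rightarrow> 'v \<Rightarrow> 'v \<Rightarrow> int) \<Rightarrow> 't \<Rightarrow> ('v \<times> 'v) set" where
  "route I x t = {(a, b) \<in> locs I \<times> locs I. x t a b = 1}"

definition delivery_locs :: "('v, 't, 'r) pdp \<Rightarrow> 'r set \<Rightarrow> 'v set" where
  "delivery_locs I D = {depot I} \<union> (\<Union>r\<in>D. {loading I r, unloading I r})"

text \<open>
  Loops \<open>(v, v)\<close> are dropped from the arc set because the library's notion of cycle admits cycles
  consisting of a single loop.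
\<close>

definition route_graph :: "('v, 't, 'r) pdp \<Rightarrow> ('v \<times> 'v) set \<Rightarrow> ('v, 'v \<times> 'v) pre_digraph" where
  "route_graph I S = \<lparr>verts = locs I, arcs = {(a, b) \<in> S. a \<noteq> b}, tail = fst, head = snd\<rparr>"

definition subtour :: "('v, 't, 'r) pdp \<Rightarrow> ('v \<times> 'v) set \<Rightarrow> ('v \<times> 'v) list \<Rightarrow> bool" where
  "subtour I S p \<longleftrightarrow>
     pre_digraph.cycle (route_graph I S) p \<and> (\<forall>(a, b)\<in>set p. a \<noteq> depot I \<and> b \<noteq> depot I)"

definition hamiltonian_cycle_condition ::
    "('v, 't, 'r) pdp \<Rightarrow> 'r set \<Rightarrow> ('v \<times> 'v) set \<Rightarrow> bool" where
  "hamiltonian_cycle_condition I D S \<longleftrightarrow>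
     (\<forall>v\<in>delivery_locs I D. (\<exists>!a. a \<noteq> v \<and> (a, v) \<in> S) \<and> (\<exists>!b. b \<noteq> v \<and> (v, b) \<in> S)) \<and>
     (\<nexists>p. subtour I S p)"

end

(* By flow conservation a truck enters every location as often as it departs from it, hence at
   most once, and exactly once at the loading and unloading points it serves.  The ordering
   variable increases strictly along every arc avoiding the depot.  Therefore no cycle avoids the
   depot, and if the truck did not use the depot, the visited location with the largest ordering
   value would have a visited successor with a larger one. *)
theory Submission
  imports Defs
begin

lemma sum_binary_eq_1_ex1:
  fixes f :: "'a \<Rightarrow> int"
  assumes "finite A" and bin: "\<And>a. a \<in> A \<Longrightarrow> f a \<in> {0, 1}" and sum: "sum f A = 1"
  shows "\<exists>!a. a \<in> A \<and> f a = 1"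
proof -
  have "sum f A = (\<Sum>a\<in>A. if f a = 1 then 1 else 0)"
    by (rule sum.cong) (use bin in auto)
  also have "\<dots> = int (card {a \<in> A. f a = 1})"
    using assms(1) by (simp add: sum.If_cases Int_def)
  finally have "card {a \<in> A. f a = 1} = 1"
    using sum by simp
  then obtain b where "{a \<in> A. f a = 1} = {b}"
    by (auto simp: card_1_singleton_iff)
  then have "a \<in> A \<and> f a = 1 \<longleftrightarrow> a = b" for a
    by (auto simp: set_eq_iff)
  then show ?thesis by simp
qed

text \<open>The inequalities along the arcs chain by transitivity. For a closed walk,
  \<open>v = w\<close> makes the conclusion absurd, so a potential that strictly increases along
  arcs rules out cycles.\<close>

lemma (in pre_digraph) cas_less:
  fixes f :: "'a \<Rightarrow> 'c::order"
  assumes "cas v p w" and "p \<noteq> []" and "\<And>e. e \<in> set p \<Longrightarrow> f (tail G e) < f (head G e)"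
  shows "f v < f w"
  using assms
proof (induction p arbitrary: v)
  case (Cons e p)
  then show ?case by (cases "p = []") (auto intro: less_trans)
qed simp

theorem theorem1:
  fixes I :: "('v, 't, 'r) pdp"
    and x :: "'t \<Rightarrow> 'v \<Rightarrow> 'v \<Rightarrow> int"
    and y :: "'t \<Rightarrow> 'r \<Rightarrow> int"
    and u :: "'t \<Rightarrow> 'v \<Rightarrow> int"
  assumes "pdp_instance I"
    and "binary_vars I x y"
    and "loading_visited I x y"
    and "unloading_visited I x y"
    and "flow_conservation I x"
    and "departed_at_most_once I x"
    and "mtz_order I x u"
    and "mtz_bounds I u"
  shows "\<forall>t\<in>trucks I. delivery I y t \<noteq> {} \<longrightarrow>
           hamiltonian_cycle_condition I (delivery I y t) (route I x t)"
proof (intro ballI impI)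
  fix t assume t: "t \<in> trucks I" and D: "delivery I y t \<noteq> {}"
  define L where "L = locs I"
  define dep where "dep = depot I"
  define outdeg where "outdeg v = (\<Sum>b\<in>L - {v}. x t v b)" for v
  define indeg where "indeg v = (\<Sum>a\<in>L - {v}. x t a v)" for v
  have finL: "finite L" and dep: "dep \<in> L"
    using assms(1) by (auto simp: pdp_instance_def L_def dep_def)
  have bin: "x t a b \<in> {0, 1}" if "a \<in> L" "b \<in> L" for a b
    using assms(2) t that by (auto simp: binary_vars_def L_def)
  \<comment> \<open>The loop term \<open>x t v v\<close> occurs in both sums of the conservation law
    and cancels, so the balance carries over to the loop-free degrees.\<close>
  have flow: "indeg v = outdeg v" if "v \<in> L" for v
  proof -
    have "(\<Sum>b\<in>L. x t v b) = (\<Sum>a\<in>L. x t a v)"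
      using assms(5) t that by (auto simp: flow_conservation_def L_def)
    then show ?thesis
      by (simp add: indeg_def outdeg_def sum_diff1 finL that)
  qed
  have out_le: "outdeg v \<le> 1" if "v \<in> L" for v
    using assms(6) t that by (auto simp: departed_at_most_once_def L_def outdeg_def)
  have out_1: "outdeg a = 1" if "a \<in> L" "b \<in> L" "a \<noteq> b" "x t a b = 1" for a b
  proof -
    have "x t a b \<le> outdeg a"
      unfolding outdeg_def by (rule member_le_sum) (use that finL bin in force)+
    then show ?thesis using that out_le by force
  qed
  \<comment> \<open>The bound on departures also limits entries, because the two degrees agree.
    Hence \<open>outdeg v = 1\<close> can serve as the single criterion for \<open>v\<close> being
    visited.\<close>
  have in_1: "outdeg b = 1" if "a \<in> L" "b \<in> L" "a \<noteq> b" "x t a b = 1" for a b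
  proof -
    have "x t a b \<le> indeg b"
      unfolding indeg_def by (rule member_le_sum[where f = "\<lambda>a. x t a b"]) (use that finL bin in force)+
    then show ?thesis using that out_le[of b] flow[of b] by simp
  qed
  have out_ex1: "\<exists>!b. b \<in> L - {v} \<and> x t v b = 1" if "v \<in> L" "outdeg v = 1" for v
    by (rule sum_binary_eq_1_ex1) (use that finL bin in \<open>auto simp: outdeg_def\<close>)
  have in_ex1: "\<exists>!a. a \<in> L - {v} \<and> x t a v = 1" if "v \<in> L" "outdeg v = 1" for v
    by (rule sum_binary_eq_1_ex1) (use that finL bin flow[of v] in \<open>auto simp: indeg_def\<close>)
  \<comment> \<open>On a used arc the factor \<open>1 - x t a b\<close> vanishes, which leaves a
    difference of at least 1.\<close>
  have incr: "u t a < u t b"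
    if "a \<in> L" "b \<in> L" "a \<noteq> b" "x t a b = 1" "a \<noteq> dep" "b \<noteq> dep" for a b
    using assms(7) t that by (fastforce simp: mtz_order_def L_def dep_def)
  have req: "loading I r \<in> L - {dep} \<and> outdeg (loading I r) = 1 \<and>
      unloading I r \<in> L - {dep} \<and> outdeg (unloading I r) = 1" if "r \<in> delivery I y t" for r
  proof -
    have r: "r \<in> requests I" "y t r = 1"
      using that by (auto simp: delivery_def)
    have L: "loading I r \<in> L - {dep}" "unloading I r \<in> L - {dep}"
      using assms(1) r by (auto simp: pdp_instance_def L_def dep_def)
    \<comment> \<open>Since \<open>y t r = 1\<close>, the visiting constraints bound these
      in-degrees from below by 1.\<close>
    have "1 \<le> indeg (loading I r)" "1 \<le> indeg (unloading I r)"
      using assms(3,4) t r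
      by (fastforce simp: loading_visited_def unloading_visited_def indeg_def L_def)+
    then show ?thesis
      using L flow out_le by (metis DiffD1 order_antisym)
  qed
  have dep_1: "outdeg dep = 1"
  proof (rule ccontr)
    assume not1: "outdeg dep \<noteq> 1"
    \<comment> \<open>\<open>W\<close> collects the visited locations. It contains the loading point
      of any delivered request, and under the assumption \<open>not1\<close> it omits the depot, so
      \<open>incr\<close> applies to every used non-loop arc within \<open>W\<close>.\<close>
    define W where "W = {v \<in> L. outdeg v = 1}"
    have "finite W" "W \<noteq> {}"
      using finL D req by (auto simp: W_def)
    then have "Max (u t ` W) \<in> u t ` W"
      by simp
    then obtain v where v: "v \<in> W" "u t v = Max (u t ` W)"
      by (metis imageE)
    then obtain w where w: "w \<in> L" "w \<noteq> v" "x t v w = 1"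
      using out_ex1[of v] by (auto simp: W_def)
    then have "outdeg w = 1"
      using in_1[of v w] v by (auto simp: W_def)
    then have "u t v < u t w" "w \<in> W"
      using incr[of v w] v w not1 by (auto simp: W_def)
    moreover have "u t w \<le> Max (u t ` W)"
      using \<open>w \<in> W\<close> \<open>finite W\<close> by simp
    ultimately show False
      using v by simp
  qed
  have visit: "(\<exists>!a. a \<noteq> v \<and> (a, v) \<in> route I x t) \<and> (\<exists>!b. b \<noteq> v \<and> (v, b) \<in> route I x t)"
    if "v \<in> delivery_locs I (delivery I y t)" for v
  proof -
    have v: "v \<in> L" "outdeg v = 1"
      using that req dep dep_1 by (auto simp: delivery_locs_def dep_def)
    \<comment> \<open>The arcs of the route have both ends in \<open>L\<close>, so uniqueness within
      \<open>L - {v}\<close> is uniqueness among all locations.\<close>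
    show ?thesis
      using out_ex1[OF v] in_ex1[OF v] v(1) by (auto simp: route_def L_def)
  qed
  have "\<not> subtour I (route I x t) p" for p
  proof
    assume st: "subtour I (route I x t) p"
    interpret pre_digraph "route_graph I (route I x t)" .
    obtain v where walk: "awalk v p v" and "p \<noteq> []"
      using st by (auto simp: subtour_def cycle_def)
    \<comment> \<open>The potential is \<open>u t\<close>: the arcs of a subtour are loop-free and
      avoid the depot at both ends, which is what \<open>incr\<close> requires.\<close>
    have "u t v < u t v"
    proof (rule cas_less)
      show "cas v p v"
        using walk by (simp add: awalk_def)
      show "u t (tail (route_graph I (route I x t)) e) < u t (head (route_graph I (route I x t)) e)"
        if "e \<in> set p" for e
      proof -
        obtain a b where e: "e = (a, b)"
          by (cases e)
        have "e \<in> arcs (route_graph I (route I x t))"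
          using that walk by (auto simp: awalk_def)
        then have "(a, b) \<in> route I x t" "a \<noteq> b"
          using e by (auto simp: route_graph_def)
        moreover have "a \<noteq> dep" "b \<noteq> dep"
          using that st e by (auto simp: subtour_def dep_def)
        ultimately show ?thesis
          using incr[of a b] e by (simp add: route_graph_def route_def L_def)
      qed
    qed fact
    then show False by simp
  qed
  with visit show "hamiltonian_cycle_condition I (delivery I y t) (route I x t)"
    by (simp add: hamiltonian_cycle_condition_def)
qed

end
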